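(* Let $\mathbb{K}$ be a field and let $I$ be a nonzero proper square-free monomial ideal in $R=\mathbb{K}[x_1,\ldots,x_n]$. Then $$\mathrm{v}(I^{(k)})\le (k-1)\,d(I)+\mathrm{v}(I)\quad\text{for all }k\ge 1.$$
   Context: $R=\mathbb{K}[x_1,\ldots,x_n]$ has its standard grading. The $k$-th symbolic power is $I^{(k)}=\bigcap_{P\in\mathrm{Min}(I)}(I^kR_P\cap R)$, where $\mathrm{Min}(I)=\mathrm{Ass}(R/I)$ is the set of minimal primes of the square-free monomial ideal $I$. $d(I)$ denotes the maximum degree of a minimal generator of $I$. For a proper graded ideal $J\subset R$, the v-number is $\mathrm{v}(J)=\min\{d\ge 0\mid \exists f\in R_d,\ \mathfrak{p}\in\mathrm{Ass}(J)\text{ with }(J:f)=\mathfrak{p}\}$, where $\mathrm{Ass}(J)$ is the set of associated primes of $R/J$. *)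

theory Defs
  imports
    "HOL-Library.Poly_Mapping"
    "HOL-Computational_Algebra.Polynomial_Factorial"
    "HOL-Algebra.QuotRing"
    "HOL-Algebra.Ideal_Product"
    "HOL-Algebra.Algebraic_Closure_Type"
begin

text \<open>
  The polynomial ring \<open>K[x\<^sub>1, \<dots>, x\<^sub>n]\<close> is the type \<open>('n, 'k) mpoly\<close>: the finite type \<open>'n\<close>
  (\<open>n = CARD('n)\<close>) indexes the variables, \<open>'n \<Rightarrow>\<^sub>0 nat\<close> is the type of exponent vectors, and
  \<open>Poly_Mapping.single u 1\<close> is the monomial with exponent vector \<open>u\<close>. The order on the variables only
  serves to obtain the library's \<open>idom\<close> instance, and hence the fraction field.
  The type viewed as a HOL-Algebra ring is the library's \<open>ring_of_type_algebra\<close>.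
\<close>

type_synonym ('n, 'k) mpoly = "('n \<Rightarrow>\<^sub>0 nat) \<Rightarrow>\<^sub>0 'k"

abbreviation ring_of :: "'a::ring_1 ring" where
  "ring_of \<equiv> ring_of_type_algebra"

section \<open>Associated and minimal primes, symbolic powers\<close>

definition colon :: "'a::idom set \<Rightarrow> 'a \<Rightarrow> 'a set" where
  "colon J f = {g. g * f \<in> J}"

text \<open>
  \<open>Ass(J)\<close>: the primes that are annihilators of an element \<open>m\<close> of the module \<open>R/J\<close>; a scalar
  \<open>r\<close> acts on \<open>R/J\<close> as multiplication by its residue class.
\<close>

definition ass_primes :: "'a::idom set \<Rightarrow> 'a set set" where
  "ass_primes J = {P. primeideal P ring_of \<and>
     (\<exists>m \<in> carrier (ring_of Quot J).
        P = {r. (J +>\<^bsub>ring_of\<^esub> r) \<otimes>\<^bsub>ring_of Quot J\<^esub> m = \<zero>\<^bsub>ring_of Quot J\<^esub>})}"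

definition min_primes :: "'a::idom set \<Rightarrow> 'a set set" where
  "min_primes I = {P. primeideal P ring_of \<and> I \<subseteq> P \<and>
     (\<forall>Q. primeideal Q ring_of \<and> I \<subseteq> Q \<and> Q \<subseteq> P \<longrightarrow> Q = P)}"

text \<open>
  The localization \<open>R\<^sub>P\<close> at a prime \<open>P\<close> of the domain \<open>R\<close>, as a subring of the fraction field.
\<close>

definition localization_at :: "'a::idom set \<Rightarrow> 'a fract ring" where
  "localization_at P = ring_of\<lparr>carrier := {Fract a s |a s. s \<notin> P}\<rparr>"

definition extension_at :: "'a::idom set \<Rightarrow> 'a set \<Rightarrow> 'a fract set" where
  "extension_at P J = Idl\<^bsub>localization_at P\<^esub> (to_fract ` J)"

definition symbolic_power :: "'a::idom set \<Rightarrow> nat \<Rightarrow> 'a set" where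
  "symbolic_power I k =
     (\<Inter>P \<in> min_primes I. {f. to_fract f \<in> extension_at P (I [^]\<^bsub>ideals_set ring_of\<^esub> k)})"

section \<open>Grading and v-number\<close>

definition mon_degree :: "('n::finite \<Rightarrow>\<^sub>0 nat) \<Rightarrow> nat" where
  "mon_degree u = (\<Sum>i\<in>UNIV. Poly_Mapping.lookup u i)"

text \<open>As usual, the graded component \<open>R\<^sub>d\<close> contains \<open>0\<close>.\<close>

definition graded_component :: "nat \<Rightarrow> ('n::finite, 'k::zero) mpoly set" where
  "graded_component d = {f. \<forall>u \<in> Poly_Mapping.keys f. mon_degree u = d}"

definition v_number :: "('n::{finite,linorder}, 'k::field) mpoly set \<Rightarrow> nat" where
  "v_number J = (LEAST d. \<exists>f \<in> graded_component d. \<exists>P \<in> ass_primes J. colon J f = P)"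

section \<open>Monomial ideals\<close>

definition monomial_ideal :: "('n \<Rightarrow>\<^sub>0 nat) set \<Rightarrow> ('n::{finite,linorder}, 'k::field) mpoly set" where
  "monomial_ideal U = Idl\<^bsub>ring_of\<^esub> ((\<lambda>u. Poly_Mapping.single u 1) ` U)"

definition is_squarefree_monomial_ideal :: "('n::{finite,linorder}, 'k::field) mpoly set \<Rightarrow> bool" where
  "is_squarefree_monomial_ideal I \<longleftrightarrow>
     (\<exists>U. (\<forall>u \<in> U. \<forall>i. Poly_Mapping.lookup u i \<le> 1) \<and> I = monomial_ideal U)"

definition is_min_mon_gens ::
    "('n::{finite,linorder}, 'k::field) mpoly set \<Rightarrow> ('n \<Rightarrow>\<^sub>0 nat) set \<Rightarrow> bool" where
  "is_min_mon_gens I U \<longleftrightarrow> monomial_ideal U = I \<and> (\<forall>V. V \<subset> U \<longrightarrow> monomial_ideal V \<noteq> I)"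

text \<open>
  A monomial ideal has exactly one minimal set of monomial generators, so the union over all
  such sets below is a union over one (finite) set.
\<close>

definition max_gen_degree :: "('n::{finite,linorder}, 'k::field) mpoly set \<Rightarrow> nat" where
  "max_gen_degree I = Max {mon_degree u |u U. is_min_mon_gens I U \<and> u \<in> U}"

end

theory Submission
  imports Defs
begin

text \<open>
  Let \<open>f\<close> be homogeneous of degree \<open>v(I)\<close> with \<open>(I : f) = P\<close>. As \<open>I\<close> is radical, \<open>f \<notin> P\<close> and \<open>P\<close> is a
  minimal prime of \<open>I\<close>, hence generated by variables. By minimality of \<open>P\<close> some minimal generator
  \<open>u\<close> of \<open>I\<close> involves exactly one of these variables, so \<open>u\<close> has \<open>P\<close>-order \<open>1\<close>. Put
  \<open>g = f u\<^sup>k\<^sup>-\<^sup>1\<close>. Then \<open>P g \<subseteq> I I\<^sup>k\<^sup>-\<^sup>1\<close> lies in the symbolic power; conversely \<open>h g\<close> in the symbolic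
  power gives \<open>s h g \<in> I\<^sup>k \<subseteq> P\<^sup>k\<close> with \<open>s \<notin> P\<close>, and since the \<open>P\<close>-order is additive and is \<open>k - 1\<close> on
  \<open>s g\<close>, \<open>h \<in> P\<close>. So \<open>g\<close> witnesses the bound.
\<close>

section \<open>Ideals of a commutative ring type\<close>

lemma ring_of_simps [simp]:
  "carrier ring_of = UNIV" "x \<otimes>\<^bsub>ring_of\<^esub> y = x * y" "x \<oplus>\<^bsub>ring_of\<^esub> y = x + y"
  "\<zero>\<^bsub>ring_of\<^esub> = 0" "\<one>\<^bsub>ring_of\<^esub> = 1"
  by (simp_all add: ring_of_type_algebra_def)

lemma ring_ring_of: "ring (ring_of :: 'a::comm_ring_1 ring)"
  by (rule ring_from_type_algebra)

lemma cring_ring_of: "cring (ring_of :: 'a::comm_ring_1 ring)"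
  by (rule cring_from_type_algebra)

text \<open>Additive inverses come from multiplication by \<open>-1\<close>.\<close>

lemma ideal_ring_of_iff:
  fixes J :: "'a::comm_ring_1 set"
  shows "ideal J ring_of \<longleftrightarrow> 0 \<in> J \<and> (\<forall>a\<in>J. \<forall>b\<in>J. a + b \<in> J) \<and> (\<forall>a\<in>J. \<forall>r. r * a \<in> J)"
    (is "_ \<longleftrightarrow> ?R")
proof
  assume "ideal J ring_of"
  then interpret ideal J "ring_of :: 'a ring" .
  show ?R
    using additive_subgroup.zero_closed[OF is_additive_subgroup]
      additive_subgroup.a_closed[OF is_additive_subgroup] I_l_closed by auto
next
  assume R: ?R
  interpret cring "ring_of :: 'a ring" by (rule cring_ring_of)
  show "ideal J ring_of"
  proof (rule idealI[OF ring_axioms])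
    have "\<ominus>\<^bsub>ring_of\<^esub> a \<in> J" if "a \<in> J" for a
    proof -
      have "(-1) * a \<in> J" using R that by blast
      moreover have "\<ominus>\<^bsub>ring_of\<^esub> a = - a"
        by (rule minus_equality) auto
      ultimately show ?thesis by simp
    qed
    then show "subgroup J (add_monoid (ring_of :: 'a ring))"
      using R by unfold_locales (auto simp: a_inv_def)
  qed (use R in \<open>auto simp: mult.commute\<close>)
qed

lemmas ideal_ring_ofD =
  ideal_ring_of_iff[THEN iffD1, THEN conjunct1]
  ideal_ring_of_iff[THEN iffD1, THEN conjunct2, THEN conjunct1, rule_format]
  ideal_ring_of_iff[THEN iffD1, THEN conjunct2, THEN conjunct2, rule_format]

lemma primeideal_ring_of_iff:
  fixes P :: "'a::comm_ring_1 set"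
  shows "primeideal P ring_of \<longleftrightarrow>
    ideal P ring_of \<and> 1 \<notin> P \<and> (\<forall>a b. a * b \<in> P \<longrightarrow> a \<in> P \<or> b \<in> P)"
proof
  assume "primeideal P ring_of"
  then interpret primeideal P "ring_of :: 'a ring" .
  show "ideal P ring_of \<and> 1 \<notin> P \<and> (\<forall>a b. a * b \<in> P \<longrightarrow> a \<in> P \<or> b \<in> P)"
    using is_ideal one_imp_carrier I_notcarr I_prime by auto
next
  assume *: "ideal P ring_of \<and> 1 \<notin> P \<and> (\<forall>a b. a * b \<in> P \<longrightarrow> a \<in> P \<or> b \<in> P)"
  then show "primeideal P ring_of"
    by (intro primeidealI) (auto simp: cring_ring_of)
qed

lemma genideal_ring_of_subset:
  fixes J :: "'a::comm_ring_1 set"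
  assumes "ideal J ring_of"
  shows "Idl\<^bsub>ring_of\<^esub> S \<subseteq> J \<longleftrightarrow> S \<subseteq> J"
  using ring.genideal_minimal[OF ring_ring_of assms, of S]
    ring.genideal_self[OF ring_ring_of, of S] by auto

text \<open>The annihilator of the residue class of \<open>f\<close> in the quotient by
  \<open>J\<close> is exactly \<open>colon J f\<close>, so this class serves as the required module
  element.\<close>

lemma ass_primesI:
  fixes J :: "'a::idom set"
  assumes J: "ideal J ring_of" and P: "primeideal P ring_of" and f: "colon J f = P"
  shows "P \<in> ass_primes J"
proof -
  interpret ideal J "ring_of :: 'a ring" by (rule J)
  let ?m = "J +>\<^bsub>ring_of\<^esub> f"
  have "?m \<in> carrier (ring_of Quot J)"
    by (simp add: FactRing_def a_rcosetsI)
  moreover have "P = {r. (J +>\<^bsub>ring_of\<^esub> r) \<otimes>\<^bsub>ring_of Quot J\<^esub> ?m = \<zero>\<^bsub>ring_of Quot J\<^esub>}"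
  proof -
    have "(J +>\<^bsub>ring_of\<^esub> r) \<otimes>\<^bsub>ring_of Quot J\<^esub> ?m = \<zero>\<^bsub>ring_of Quot J\<^esub> \<longleftrightarrow> r * f \<in> J" for r
      using rcoset_mult_add[of r f] a_rcos_self[of "r * f"] a_rcos_const[of "r * f"]
      by (auto simp: FactRing_def)
    then show ?thesis using f by (auto simp: colon_def)
  qed
  ultimately show ?thesis using P unfolding ass_primes_def by blast
qed

section \<open>Powers and symbolic powers\<close>

abbreviation ideal_pow :: "'a::ring_1 set \<Rightarrow> nat \<Rightarrow> 'a set" where
  "ideal_pow I k \<equiv> I [^]\<^bsub>ideals_set ring_of\<^esub> k"

text \<open>The unit of the monoid of ideals is the whole ring; hence the zeroth power of an ideal
  is \<open>UNIV\<close>, the base case of the inductions on the exponent.\<close>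

lemma ideals_set_simps [simp]:
  "\<one>\<^bsub>ideals_set ring_of\<^esub> = UNIV"
  "I \<otimes>\<^bsub>ideals_set ring_of\<^esub> J = ideal_prod ring_of I J"
  by (simp_all add: ideals_set_def)

lemma ideal_ideal_pow:
  fixes I :: "'a::comm_ring_1 set"
  assumes "ideal I ring_of"
  shows "ideal (ideal_pow I k) ring_of"
proof (induction k)
  case 0
  show ?case by (simp add: ideal_ring_of_iff)
next
  case (Suc k)
  then show ?case
    by (simp add: ring.ideal_prod_is_ideal ring_ring_of assms)
qed

lemma ideal_pow_Suc_memI:
  fixes I :: "'a::comm_ring_1 set"
  assumes "a \<in> ideal_pow I k" "b \<in> I"
  shows "a * b \<in> ideal_pow I (Suc k)"
  using ideal_prod.prod[OF assms, of ring_of] by simp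

lemma power_in_ideal_pow:
  fixes I :: "'a::comm_ring_1 set"
  assumes "b \<in> I"
  shows "b ^ k \<in> ideal_pow I k"
proof (induction k)
  case 0
  show ?case by simp
next
  case (Suc k)
  show ?case
    using ideal_pow_Suc_memI[OF Suc assms] by (simp add: mult.commute)
qed

text \<open>The fractions with numerator in \<open>J\<close> contain the image of \<open>J\<close>;
  knowing that they form an ideal bounds the generated ideal \<open>extension_at P J\<close> from
  above.\<close>

lemma ideal_localization_fractions:
  fixes J P :: "'a::idom set"
  assumes P: "primeideal P ring_of" and J: "ideal J ring_of"
  shows "ring (localization_at P)"
    and "ideal {Fract a s |a s. a \<in> J \<and> s \<notin> P} (localization_at P)" (is "ideal ?F _")
proof -
  let ?K = "ring_of :: 'a fract ring"
  let ?C = "{Fract a s |a s. s \<notin> P}"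
  interpret K: cring ?K by (rule cring_ring_of)
  \<comment> \<open>By convention \<open>Fract a 0\<close> is \<open>0\<close>. As \<open>0\<close>
    lies in \<open>P\<close>, denominators outside \<open>P\<close> are nonzero and the usual rules
    for fractions apply.\<close>
  have P0: "s \<noteq> 0" if "s \<notin> P" for s
    using P that by (auto simp: primeideal_ring_of_iff ideal_ring_of_iff)
  have Pm: "s * t \<notin> P" if "s \<notin> P" "t \<notin> P" for s t
    using P that by (auto simp: primeideal_ring_of_iff)
  have P1: "1 \<notin> P" using P by (simp add: primeideal_ring_of_iff)
  have minus: "\<ominus>\<^bsub>?K\<^esub> x = - x" for x
    by (rule K.minus_equality) auto
  have "subring ?C ?K"
  proof (rule K.subringI)
    fix x assume "x \<in> ?C"
    then obtain a s where "x = Fract a s" "s \<notin> P" by blast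
    then have "- x = Fract (- a) s" by simp
    with \<open>s \<notin> P\<close> show "\<ominus>\<^bsub>?K\<^esub> x \<in> ?C"
      unfolding minus by blast
  next
    fix x y assume "x \<in> ?C" "y \<in> ?C"
    then obtain a s b t where xy: "x = Fract a s" "s \<notin> P" "y = Fract b t" "t \<notin> P" by blast
    show "x \<oplus>\<^bsub>?K\<^esub> y \<in> ?C"
      using xy Pm[of s t] P0 by auto
    show "x \<otimes>\<^bsub>?K\<^esub> y \<in> ?C"
      using xy Pm[of s t] P0 by auto
  qed (use P1 in \<open>auto simp: One_fract_def\<close>)
  then have "ring (?K\<lparr>carrier := ?C\<rparr>)"
    by (rule K.subring_is_ring)
  then show R: "ring (localization_at P)"
    by (simp add: localization_at_def)
  interpret L: ring "localization_at P" by (rule R)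
  have Lsimps: "carrier (localization_at P) = ?C" "x \<oplus>\<^bsub>localization_at P\<^esub> y = x + y"
     "x \<otimes>\<^bsub>localization_at P\<^esub> y = x * y" "\<zero>\<^bsub>localization_at P\<^esub> = 0" for x y
    by (simp_all add: localization_at_def ring_of_type_algebra_def)
  have FC: "?F \<subseteq> ?C" by blast
  have Fadd: "x + y \<in> ?F" if "x \<in> ?F" "y \<in> ?F" for x y
  proof -
    obtain a s b t where xy: "x = Fract a s" "a \<in> J" "s \<notin> P" "y = Fract b t" "b \<in> J" "t \<notin> P"
      using \<open>x \<in> ?F\<close> \<open>y \<in> ?F\<close> by blast
    have "a * t + b * s \<in> J"
      using J xy by (metis ideal_ring_ofD(2,3) mult.commute)
    then show ?thesis
      using xy Pm[of s t] P0 by auto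
  qed
  have Fmult: "y * x \<in> ?F" if "x \<in> ?F" "y \<in> ?C" for x y
  proof -
    obtain a s b t where xy: "x = Fract a s" "a \<in> J" "s \<notin> P" "y = Fract b t" "t \<notin> P"
      using \<open>x \<in> ?F\<close> \<open>y \<in> ?C\<close> by blast
    have "b * a \<in> J"
      using J xy by (metis ideal_ring_ofD(3))
    then show ?thesis
      using xy Pm[of t s] by auto
  qed
  have F0: "0 \<in> ?F"
    using P1 ideal_ring_ofD(1)[OF J] by (auto simp: Zero_fract_def)
  show "ideal ?F (localization_at P)"
  proof (rule idealI[OF R])
    have minus: "\<ominus>\<^bsub>localization_at P\<^esub> x \<in> ?F" if x: "x \<in> ?F" for x
    proof -
      obtain a s where as: "x = Fract a s" "a \<in> J" "s \<notin> P" using x by blast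
      have "- a \<in> J" using ideal_ring_ofD(3)[OF J as(2), of "-1"] by simp
      moreover have "- x = Fract (- a) s" using as by simp
      ultimately have "- x \<in> ?F" using as(3) by blast
      moreover have "\<ominus>\<^bsub>localization_at P\<^esub> x = - x"
        using x \<open>- x \<in> ?F\<close> FC by (intro L.minus_equality) (auto simp: Lsimps)
      ultimately show ?thesis by simp
    qed
    show "subgroup ?F (add_monoid (localization_at P))"
    proof (rule subgroup.intro)
      show "?F \<subseteq> carrier (add_monoid (localization_at P))"
        using FC by (simp add: Lsimps)
      show "x \<otimes>\<^bsub>add_monoid (localization_at P)\<^esub> y \<in> ?F" if "x \<in> ?F" "y \<in> ?F" for x y
        using Fadd[OF that] by (simp add: Lsimps)
      show "\<one>\<^bsub>add_monoid (localization_at P)\<^esub> \<in> ?F"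
        using F0 by (simp add: Lsimps)
      show "inv\<^bsub>add_monoid (localization_at P)\<^esub> x \<in> ?F" if "x \<in> ?F" for x
        using minus[OF that] by (simp add: a_inv_def)
    qed
  next
    fix x y assume "x \<in> ?F" "y \<in> carrier (localization_at P)"
    then show "y \<otimes>\<^bsub>localization_at P\<^esub> x \<in> ?F" "x \<otimes>\<^bsub>localization_at P\<^esub> y \<in> ?F"
      using Fmult by (simp_all add: Lsimps mult.commute)
  qed
qed

text \<open>Clearing the denominator of a fraction with numerator in \<open>J\<close> gives one
  direction, scaling \<open>s * f\<close> by \<open>Fract 1 s\<close> the other. Through this,
  symbolic powers are handled below without fractions.\<close>

lemma to_fract_in_extension_at_iff:
  fixes J P :: "'a::idom set"
  assumes P: "primeideal P ring_of" and J: "ideal J ring_of"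
  shows "to_fract f \<in> extension_at P J \<longleftrightarrow> (\<exists>s. s \<notin> P \<and> s * f \<in> J)"
proof
  let ?F = "{Fract a s |a s. a \<in> J \<and> s \<notin> P}"
  have P0: "s \<noteq> 0" if "s \<notin> P" for s
    using P that by (auto simp: primeideal_ring_of_iff ideal_ring_of_iff)
  have P1: "1 \<notin> P" using P by (simp add: primeideal_ring_of_iff)
  interpret L: ring "localization_at P"
    by (rule ideal_localization_fractions(1)[OF P J])
  {
    assume "to_fract f \<in> extension_at P J"
    moreover have "extension_at P J \<subseteq> ?F"
      unfolding extension_at_def
      using P1 by (intro L.genideal_minimal ideal_localization_fractions(2)[OF P J])
        (auto simp: to_fract_def)
    ultimately obtain a s where "to_fract f = Fract a s" "a \<in> J" "s \<notin> P" by blast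
    then have "s * f = a"
      using P0[of s] by (simp add: to_fract_def eq_fract mult.commute)
    with \<open>a \<in> J\<close> \<open>s \<notin> P\<close> show "\<exists>s. s \<notin> P \<and> s * f \<in> J" by blast
  next
    assume "\<exists>s. s \<notin> P \<and> s * f \<in> J"
    then obtain s where s: "s \<notin> P" "s * f \<in> J" by blast
    have sub: "to_fract ` J \<subseteq> carrier (localization_at P)"
      using P1 by (auto simp: localization_at_def to_fract_def)
    interpret E: ideal "extension_at P J" "localization_at P"
      unfolding extension_at_def by (rule L.genideal_ideal[OF sub])
    have "to_fract (s * f) \<in> extension_at P J"
      using L.genideal_self[OF sub] s(2) by (auto simp: extension_at_def)
    moreover have "Fract 1 s \<in> carrier (localization_at P)"
      using s(1) by (auto simp: localization_at_def)
    ultimately have "Fract 1 s \<otimes>\<^bsub>localization_at P\<^esub> to_fract (s * f) \<in> extension_at P J"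
      by (rule E.I_l_closed)
    moreover have "Fract 1 s \<otimes>\<^bsub>localization_at P\<^esub> to_fract (s * f) = to_fract f"
      using P0[OF s(1)]
      by (simp add: localization_at_def to_fract_def ring_of_type_algebra_def eq_fract del: to_fract_mult)
    ultimately show "to_fract f \<in> extension_at P J" by simp
  }
qed

lemma in_symbolic_power_iff:
  fixes I :: "'a::idom set"
  assumes "ideal I ring_of"
  shows "f \<in> symbolic_power I k \<longleftrightarrow>
    (\<forall>P\<in>min_primes I. \<exists>s. s \<notin> P \<and> s * f \<in> ideal_pow I k)"
  using to_fract_in_extension_at_iff[OF _ ideal_ideal_pow[OF assms]]
  by (auto simp: symbolic_power_def min_primes_def)

lemma ideal_symbolic_power:
  fixes I :: "'a::idom set"
  assumes I: "ideal I ring_of"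
  shows "ideal (symbolic_power I k) ring_of"
  unfolding ideal_ring_of_iff
proof (intro conjI ballI allI)
  note IP = ideal_ring_ofD[OF ideal_ideal_pow[OF I, of k]]
  have P1: "1 \<notin> P" if "P \<in> min_primes I" for P
    using that by (simp add: min_primes_def primeideal_ring_of_iff)
  show "0 \<in> symbolic_power I k"
    using P1 IP(1) by (auto simp: in_symbolic_power_iff[OF I])
  show "a + b \<in> symbolic_power I k" if ab: "a \<in> symbolic_power I k" "b \<in> symbolic_power I k" for a b
    unfolding in_symbolic_power_iff[OF I]
  proof
    fix P assume P: "P \<in> min_primes I"
    then obtain s t where st: "s \<notin> P" "s * a \<in> ideal_pow I k" "t \<notin> P" "t * b \<in> ideal_pow I k"
      using ab unfolding in_symbolic_power_iff[OF I] by blast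
    \<comment> \<open>The product of the two multipliers works for both summands and avoids
      \<open>P\<close> by primality.\<close>
    have "s * t \<notin> P" using P st by (auto simp: min_primes_def primeideal_ring_of_iff)
    moreover have "t * (s * a) + s * (t * b) \<in> ideal_pow I k"
      using IP(2,3) st by blast
    ultimately show "\<exists>s. s \<notin> P \<and> s * (a + b) \<in> ideal_pow I k"
      by (intro exI[of _ "s * t"]) (simp add: algebra_simps)
  qed
  show "r * a \<in> symbolic_power I k" if "a \<in> symbolic_power I k" for a r
    using that IP(3)[of _ r] unfolding in_symbolic_power_iff[OF I]
    by (metis mult.left_commute)
qed

lemma ideal_pow_subset_symbolic_power:
  fixes I :: "'a::idom set"
  assumes I: "ideal I ring_of"
  shows "ideal_pow I k \<subseteq> symbolic_power I k"
proof
  fix f assume "f \<in> ideal_pow I k"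
  then show "f \<in> symbolic_power I k"
    unfolding in_symbolic_power_iff[OF I]
    by (auto simp: min_primes_def primeideal_ring_of_iff intro!: exI[of _ 1])
qed

section \<open>The order of a polynomial along a coordinate subspace\<close>

text \<open>The order of vanishing of the monomial with exponent vector \<open>u\<close> along the
  subspace where all variables in \<open>C\<close> are zero.\<close>

definition var_weight :: "'n set \<Rightarrow> ('n \<Rightarrow>\<^sub>0 nat) \<Rightarrow> nat" where
  "var_weight C u = (\<Sum>i\<in>C. Poly_Mapping.lookup u i)"

text \<open>For the prime \<open>P\<close> generated by the variables in \<open>C\<close> this is \<open>P\<^sup>m\<close>.\<close>

definition var_ideal :: "'n set \<Rightarrow> nat \<Rightarrow> ('n::{finite,linorder}, 'k::field) mpoly set" where
  "var_ideal C m = {f. \<forall>w \<in> Poly_Mapping.keys f. m \<le> var_weight C w}"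

lemma var_weight_add: "var_weight C (u + v) = var_weight C u + var_weight C v"
  by (simp add: var_weight_def lookup_add sum.distrib)

lemma var_ideal_add: "f \<in> var_ideal C m \<Longrightarrow> g \<in> var_ideal C m \<Longrightarrow> f + g \<in> var_ideal C m"
  using keys_add[of f g] unfolding var_ideal_def by blast

lemma var_ideal_mult:
  assumes "f \<in> var_ideal C m" "g \<in> var_ideal C l"
  shows "f * g \<in> var_ideal C (m + l)"
proof -
  have "m + l \<le> var_weight C w" if "w \<in> Poly_Mapping.keys (f * g)" for w
  proof -
    obtain a b where "w = a + b" "a \<in> Poly_Mapping.keys f" "b \<in> Poly_Mapping.keys g"
      using \<open>w \<in> _\<close> keys_mult[of f g] by blast
    then show ?thesis
      using assms by (auto simp: var_ideal_def var_weight_add intro: add_mono)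
  qed
  then show ?thesis by (simp add: var_ideal_def)
qed

lemma var_ideal_0: "var_ideal C 0 = UNIV"
  by (simp add: var_ideal_def)

lemma ideal_var_ideal: "ideal (var_ideal C m :: ('n::{finite,linorder}, 'k::field) mpoly set) ring_of"
  unfolding ideal_ring_of_iff
  using var_ideal_add var_ideal_mult[of _ C 0 _ m]
  by (auto simp: var_ideal_0) (simp add: var_ideal_def)

text \<open>Here \<open>m\<close> is the least weight of a term of \<open>f\<close>, and
  \<open>f0\<close> is the leading form: the sum of all terms of that weight.\<close>

lemma leading_form_split:
  fixes f :: "('n::{finite,linorder}, 'k::field) mpoly"
  assumes "f \<notin> var_ideal C (Suc a)"
  obtains m f0 f1 where "m \<le> a" "f = f0 + f1" "f0 \<noteq> 0" "f1 \<in> var_ideal C (Suc m)"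
    "\<And>w. w \<in> Poly_Mapping.keys f0 \<Longrightarrow> var_weight C w = m"
proof -
  obtain w0 where w0: "w0 \<in> Poly_Mapping.keys f" "var_weight C w0 \<le> a"
    using assms by (auto simp: var_ideal_def not_less_eq_eq)
  then obtain w1 where w1: "w1 \<in> Poly_Mapping.keys f"
    "\<And>w. w \<in> Poly_Mapping.keys f \<Longrightarrow> var_weight C w1 \<le> var_weight C w"
    using ex_has_least_nat[of "\<lambda>w. w \<in> Poly_Mapping.keys f" w0 "var_weight C"] by blast
  define m where "m = var_weight C w1"
  define f0 where "f0 = Poly_Mapping.mapp (\<lambda>w c. if var_weight C w = m then c else 0) f"
  have l0: "Poly_Mapping.lookup f0 w = (if var_weight C w = m then Poly_Mapping.lookup f w else 0)" for w
    by (auto simp: f0_def lookup_mapp in_keys_iff when_def)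
  show thesis
  proof (rule that[of m f0 "f - f0"])
    show "m \<le> a" using w0 w1(2)[of w0] by (simp add: m_def)
    have "Poly_Mapping.lookup f0 w1 \<noteq> 0"
      using w1(1) by (simp add: l0 m_def in_keys_iff)
    then show "f0 \<noteq> 0" by auto
    show "f - f0 \<in> var_ideal C (Suc m)"
      using w1(2) by (force simp: var_ideal_def in_keys_iff lookup_minus l0 m_def Suc_le_eq
        le_less split: if_splits)
  qed (auto simp: in_keys_iff l0 split: if_splits)
qed

text \<open>The product of the two leading forms is nonzero.\<close>

lemma var_ideal_mult_notin:
  fixes f g :: "('n::{finite,linorder}, 'k::field) mpoly"
  assumes "f \<notin> var_ideal C (Suc a)" "g \<notin> var_ideal C (Suc b)"
  shows "f * g \<notin> var_ideal C (Suc (a + b))"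
proof -
  obtain m f0 f1 where f: "m \<le> a" "f = f0 + f1" "f0 \<noteq> 0" "f1 \<in> var_ideal C (Suc m)"
    "\<And>w. w \<in> Poly_Mapping.keys f0 \<Longrightarrow> var_weight C w = m"
    using leading_form_split[OF assms(1)] by metis
  obtain l g0 g1 where g: "l \<le> b" "g = g0 + g1" "g0 \<noteq> 0" "g1 \<in> var_ideal C (Suc l)"
    "\<And>w. w \<in> Poly_Mapping.keys g0 \<Longrightarrow> var_weight C w = l"
    using leading_form_split[OF assms(2)] by metis
  have "g0 \<in> var_ideal C l" "f0 \<in> var_ideal C m"
    using f(5) g(5) by (auto simp: var_ideal_def)
  moreover have "g1 \<in> var_ideal C l"
    using g(4) by (auto simp: var_ideal_def)
  ultimately have "f0 * g1 \<in> var_ideal C (m + Suc l)" "f1 * g \<in> var_ideal C (Suc m + l)"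
    using f(4) g(2,4) var_ideal_add[of g0 C l g1]
    by (auto intro!: var_ideal_mult simp del: add_Suc add_Suc_right)
  then have rest: "f0 * g1 + f1 * g \<in> var_ideal C (Suc (m + l))"
    by (auto intro: var_ideal_add)
  have "f0 * g0 \<noteq> 0" using f g by simp
  then obtain w where w: "w \<in> Poly_Mapping.keys (f0 * g0)"
    using keys_eq_empty by fastforce
  \<comment> \<open>The term at \<open>w\<close> cannot cancel: its weight is \<open>m + l\<close>,
    while all other contributions to \<open>f * g\<close> have larger weight.\<close>
  then have ww: "var_weight C w = m + l"
    using keys_mult[of f0 g0] f(5) g(5) by (auto simp: var_weight_add)
  then have "w \<notin> Poly_Mapping.keys (f0 * g1 + f1 * g)"
    using rest by (auto simp: var_ideal_def)
  moreover have "f * g = f0 * g0 + (f0 * g1 + f1 * g)"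
    using f g by (simp add: algebra_simps)
  ultimately have "w \<in> Poly_Mapping.keys (f * g)"
    using w by (simp add: in_keys_iff lookup_add)
  then show ?thesis
    using ww f(1) g(1) by (auto simp: var_ideal_def not_less_eq_eq intro!: bexI[of _ w])
qed

text \<open>Primality is the case of order zero in \<open>var_ideal_mult_notin\<close>.\<close>

lemma primeideal_var_ideal:
  "primeideal (var_ideal C 1 :: ('n::{finite,linorder}, 'k::field) mpoly set) ring_of"
  unfolding primeideal_ring_of_iff
  using ideal_var_ideal[of C 1] var_ideal_mult_notin[of _ C 0 _ 0]
  by (auto simp: var_ideal_def var_weight_def)

text \<open>Orders add up in products and do not drop in sums. This is the obstruction that keeps
  elements of small order out of powers of \<open>I\<close>.\<close>

lemma ideal_pow_subset_var_ideal:
  assumes "I \<subseteq> var_ideal C 1"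
  shows "ideal_pow I k \<subseteq> (var_ideal C k :: ('n::{finite,linorder}, 'k::field) mpoly set)"
proof (induction k)
  case 0
  show ?case by (simp add: var_ideal_0)
next
  case (Suc k)
  show ?case
  proof
    fix x assume "x \<in> ideal_pow I (Suc k)"
    then have "x \<in> ideal_prod ring_of (ideal_pow I k) I" by simp
    then show "x \<in> var_ideal C (Suc k)"
    proof induction
      case (prod i j)
      then show ?case using var_ideal_mult[of i C k j 1] Suc assms by auto
    qed (auto intro: var_ideal_add)
  qed
qed

section \<open>Monomial ideals\<close>

abbreviation monomial :: "('n \<Rightarrow>\<^sub>0 nat) \<Rightarrow> ('n::{finite,linorder}, 'k::field) mpoly" where
  "monomial u \<equiv> Poly_Mapping.single u 1"

definition exp_dvd :: "('n \<Rightarrow>\<^sub>0 nat) \<Rightarrow> ('n \<Rightarrow>\<^sub>0 nat) \<Rightarrow> bool" where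
  "exp_dvd u w \<longleftrightarrow> (\<forall>i. Poly_Mapping.lookup u i \<le> Poly_Mapping.lookup w i)"

lemma exp_dvd_refl [simp]: "exp_dvd u u"
  by (simp add: exp_dvd_def)

lemma exp_dvd_trans: "exp_dvd u v \<Longrightarrow> exp_dvd v w \<Longrightarrow> exp_dvd u w"
  unfolding exp_dvd_def using le_trans by blast

lemma exp_dvd_antisym: "exp_dvd u v \<Longrightarrow> exp_dvd v u \<Longrightarrow> u = v"
  by (simp add: exp_dvd_def poly_mapping_eqI order_antisym)

lemma exp_dvd_add: "exp_dvd u w \<Longrightarrow> exp_dvd u (v + w)"
  by (simp add: exp_dvd_def lookup_add trans_le_add2)

lemma exp_dvd_split: "exp_dvd u w \<Longrightarrow> (w - u) + u = w"
  by (rule poly_mapping_eqI) (simp add: exp_dvd_def lookup_add lookup_minus)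

lemma poly_mapping_nonzeroE:
  assumes "f \<noteq> 0"
  obtains i where "Poly_Mapping.lookup f i \<noteq> 0"
  using assms poly_mapping_eqI[of f 0] by auto

lemma poly_mapping_sum_monomials:
  "(\<Sum>w\<in>Poly_Mapping.keys f. Poly_Mapping.single w (Poly_Mapping.lookup f w)) = f"
  by (rule poly_mapping_eqI)
    (simp add: lookup_sum lookup_single when_def in_keys_iff)

text \<open>Makes the total degree a measure for induction along proper divisibility of
  monomials.\<close>

lemma mon_degree_less_if_exp_dvd:
  assumes "exp_dvd u w" "u \<noteq> w"
  shows "mon_degree u < mon_degree w"
proof -
  obtain i where "Poly_Mapping.lookup u i \<noteq> Poly_Mapping.lookup w i"
    using assms(2) poly_mapping_eqI[of u w] by auto
  moreover have "Poly_Mapping.lookup u i \<le> Poly_Mapping.lookup w i"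
    using assms(1) by (simp add: exp_dvd_def)
  ultimately have "\<exists>i\<in>UNIV. Poly_Mapping.lookup u i < Poly_Mapping.lookup w i"
    by (intro bexI[of _ i]) simp_all
  then show ?thesis
    unfolding mon_degree_def using assms(1)
    by (intro sum_strict_mono_ex1) (simp_all add: exp_dvd_def)
qed

lemma ideal_monomial_ideal: "ideal (monomial_ideal U) ring_of"
  unfolding monomial_ideal_def
  by (rule ring.genideal_ideal[OF ring_ring_of]) simp

text \<open>The polynomials with the property on the right form an ideal containing the generators.
  Conversely, such a polynomial is the sum of its terms, each a multiple of a generator.\<close>

lemma monomial_ideal_iff:
  fixes f :: "('n::{finite,linorder}, 'k::field) mpoly"
  shows "f \<in> monomial_ideal U \<longleftrightarrow> (\<forall>w\<in>Poly_Mapping.keys f. \<exists>u\<in>U. exp_dvd u w)"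
proof
  let ?M = "{f :: ('n, 'k) mpoly. \<forall>w\<in>Poly_Mapping.keys f. \<exists>u\<in>U. exp_dvd u w}"
  have "ideal ?M ring_of"
    unfolding ideal_ring_of_iff
  proof (intro conjI ballI allI)
    show "a + b \<in> ?M" if "a \<in> ?M" "b \<in> ?M" for a b
      using that keys_add[of a b] by blast
    show "r * a \<in> ?M" if "a \<in> ?M" for a r
    proof (rule CollectI, rule ballI)
      fix w assume "w \<in> Poly_Mapping.keys (r * a)"
      then obtain x y where "w = x + y" "y \<in> Poly_Mapping.keys a"
        using keys_mult[of r a] by blast
      then show "\<exists>u\<in>U. exp_dvd u w"
        using that by (auto intro: exp_dvd_add)
    qed
  qed simp
  then have "monomial_ideal U \<subseteq> ?M"
    unfolding monomial_ideal_def by (subst genideal_ring_of_subset) (auto intro: exp_dvd_refl)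
  then show "f \<in> monomial_ideal U \<Longrightarrow> \<forall>w\<in>Poly_Mapping.keys f. \<exists>u\<in>U. exp_dvd u w"
    by blast
next
  note I = ideal_ring_ofD[OF ideal_monomial_ideal[of U]]
  assume *: "\<forall>w\<in>Poly_Mapping.keys f. \<exists>u\<in>U. exp_dvd u w"
  have gen: "monomial u \<in> monomial_ideal U" if "u \<in> U" for u
    using ring.genideal_self[OF ring_ring_of, of "monomial ` U"] that
    by (auto simp: monomial_ideal_def)
  have term_in: "Poly_Mapping.single w (Poly_Mapping.lookup f w) \<in> monomial_ideal U"
    if "w \<in> Poly_Mapping.keys f" for w
  proof -
    from *[rule_format, OF that] obtain u where u: "u \<in> U" "exp_dvd u w" ..
    have "Poly_Mapping.single (w - u) (Poly_Mapping.lookup f w) * monomial u \<in> monomial_ideal U"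
      by (rule I(3)[OF gen[OF u(1)]])
    then show ?thesis
      using exp_dvd_split[OF u(2)] by (simp add: mult_single)
  qed
  have "(\<Sum>w\<in>A. Poly_Mapping.single w (Poly_Mapping.lookup f w)) \<in> monomial_ideal U"
    if "A \<subseteq> Poly_Mapping.keys f" for A
    using finite_subset[OF that finite_keys] that
  proof (induction rule: finite_induct)
    case empty
    show ?case using I(1) by simp
  next
    case (insert w A)
    have "Poly_Mapping.single w (Poly_Mapping.lookup f w) \<in> monomial_ideal U"
      using insert.prems by (intro term_in) simp
    moreover have "(\<Sum>w\<in>A. Poly_Mapping.single w (Poly_Mapping.lookup f w)) \<in> monomial_ideal U"
      using insert.prems by (intro insert.IH) simp
    ultimately show ?case
      unfolding sum.insert[OF insert.hyps] by (rule I(2))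
  qed
  from this[OF order_refl] show "f \<in> monomial_ideal U"
    by (simp only: poly_mapping_sum_monomials)
qed

lemma monomial_in_monomial_ideal_iff:
  "(monomial w :: ('n::{finite,linorder}, 'k::field) mpoly) \<in> monomial_ideal U \<longleftrightarrow> (\<exists>u\<in>U. exp_dvd u w)"
  by (simp add: monomial_ideal_iff)

text \<open>Inclusion of a generated ideal is tested on generators. The condition says that
  \<open>C\<close> is a vertex cover: it meets the support of each \<open>u\<close>.\<close>

lemma monomial_ideal_subset_var_ideal_iff:
  "(monomial_ideal U :: ('n::{finite,linorder}, 'k::field) mpoly set) \<subseteq> var_ideal C 1 \<longleftrightarrow>
    (\<forall>u\<in>U. var_weight C u \<noteq> 0)"
proof -
  have "monomial u \<in> (var_ideal C 1 :: ('n, 'k) mpoly set) \<longleftrightarrow> var_weight C u \<noteq> 0" for u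
    by (auto simp: var_ideal_def)
  then show ?thesis
    unfolding monomial_ideal_def genideal_ring_of_subset[OF ideal_var_ideal] image_subset_iff
    by simp
qed

section \<open>Minimal monomial generators and their degrees\<close>

definition min_exps :: "('n \<Rightarrow>\<^sub>0 nat) set \<Rightarrow> ('n \<Rightarrow>\<^sub>0 nat) set" where
  "min_exps U = {u \<in> U. \<forall>v\<in>U. exp_dvd v u \<longrightarrow> v = u}"

text \<open>A non-minimal vector has a proper divisor in \<open>U\<close>, of smaller degree;
  descend.\<close>

lemma min_exps_exp_dvd:
  fixes u :: "'n::finite \<Rightarrow>\<^sub>0 nat"
  assumes "u \<in> U"
  shows "\<exists>v\<in>min_exps U. exp_dvd v u"
  using assms
proof (induction "mon_degree u" arbitrary: u rule: less_induct)
  case less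
  show ?case
  proof (cases "u \<in> min_exps U")
    case False
    then obtain v where "v \<in> U" "exp_dvd v u" "v \<noteq> u"
      using less.prems by (auto simp: min_exps_def)
    then show ?thesis
      using less.hyps[of v] mon_degree_less_if_exp_dvd exp_dvd_trans by blast
  qed (use exp_dvd_refl in blast)
qed

lemma monomial_ideal_min_exps: "monomial_ideal (min_exps U) = monomial_ideal U"
proof -
  have "(\<exists>u\<in>min_exps U. exp_dvd u w) \<longleftrightarrow> (\<exists>u\<in>U. exp_dvd u w)" for w
    using min_exps_exp_dvd exp_dvd_trans by (metis (no_types, lifting) mem_Collect_eq min_exps_def)
  then show ?thesis
    by (auto simp: monomial_ideal_iff)
qed

text \<open>Once \<open>v\<close> is dropped, its monomial is lost: by minimality no other element
  of \<open>min_exps U\<close> divides it.\<close>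

lemma is_min_mon_gens_min_exps:
  "is_min_mon_gens (monomial_ideal U :: ('n::{finite,linorder}, 'k::field) mpoly set) (min_exps U)"
  unfolding is_min_mon_gens_def
proof (intro conjI allI impI)
  fix W assume W: "W \<subset> min_exps U"
  then obtain v where v: "v \<in> min_exps U" "v \<notin> W" by blast
  have "(monomial v :: ('n, 'k) mpoly) \<in> monomial_ideal U"
    using v(1) by (auto simp: monomial_in_monomial_ideal_iff min_exps_def intro: bexI[of _ v])
  moreover have "(monomial v :: ('n, 'k) mpoly) \<notin> monomial_ideal W"
    using v W by (auto simp: monomial_in_monomial_ideal_iff min_exps_def)
  ultimately show "monomial_ideal W \<noteq> (monomial_ideal U :: ('n, 'k) mpoly set)" by blast
qed (rule monomial_ideal_min_exps)

text \<open>Each \<open>v\<close> in \<open>V\<close> is divisible by some \<open>u\<close> in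
  \<open>U\<close>, and that \<open>u\<close> by some \<open>v'\<close> in \<open>V\<close>.
  Irredundancy of \<open>V\<close> forces \<open>v' = v\<close>, hence \<open>u = v\<close>.\<close>

lemma is_min_mon_gens_subset:
  assumes "is_min_mon_gens (monomial_ideal U :: ('n::{finite,linorder}, 'k::field) mpoly set) V"
  shows "V \<subseteq> U"
proof
  fix v assume v: "v \<in> V"
  have eq: "monomial_ideal V = (monomial_ideal U :: ('n, 'k) mpoly set)"
    and min: "\<And>W. W \<subset> V \<Longrightarrow> monomial_ideal W \<noteq> (monomial_ideal U :: ('n, 'k) mpoly set)"
    using assms by (auto simp: is_min_mon_gens_def)
  have VU: "(\<exists>u\<in>V. exp_dvd u w) \<longleftrightarrow> (\<exists>u\<in>U. exp_dvd u w)" for w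
    using eq monomial_in_monomial_ideal_iff[where 'k = 'k, of w] by metis
  \<comment> \<open>A second divisor of \<open>v\<close> in \<open>V\<close> would make
    \<open>v\<close> redundant as a generator.\<close>
  have vmin: "v' = v" if "v' \<in> V" "exp_dvd v' v" for v'
  proof (rule ccontr)
    assume ne: "v' \<noteq> v"
    have "(\<exists>u\<in>V - {v}. exp_dvd u w) \<longleftrightarrow> (\<exists>u\<in>V. exp_dvd u w)" for w
      using that ne exp_dvd_trans by (metis DiffE DiffI singletonD)
    then have "monomial_ideal (V - {v}) = (monomial_ideal V :: ('n, 'k) mpoly set)"
      by (auto simp: monomial_ideal_iff)
    then show False
      using min[of "V - {v}"] eq v by auto
  qed
  obtain u where u: "u \<in> U" "exp_dvd u v" using VU v exp_dvd_refl by blast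
  obtain v' where "v' \<in> V" "exp_dvd v' u" using VU u(1) exp_dvd_refl by blast
  then have "u = v"
    using vmin u(2) exp_dvd_trans exp_dvd_antisym by blast
  then show "v \<in> U" using u(1) by simp
qed

text \<open>\<open>Max\<close> bounds its elements only on a finite set. Finiteness holds because
  minimal generators lie in \<open>U\<close>, where square-freeness bounds degrees by the number of
  variables.\<close>

lemma mon_degree_le_max_gen_degree:
  fixes U :: "('n::{finite,linorder} \<Rightarrow>\<^sub>0 nat) set"
  assumes sqf: "\<forall>u\<in>U. \<forall>i. Poly_Mapping.lookup u i \<le> 1" and u: "u \<in> min_exps U"
  shows "mon_degree u \<le> max_gen_degree (monomial_ideal U :: ('n, 'k::field) mpoly set)"
  unfolding max_gen_degree_def
proof (rule Max_ge)
  let ?D = "{mon_degree u |u V. is_min_mon_gens (monomial_ideal U :: ('n, 'k) mpoly set) V \<and> u \<in> V}"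
  have "mon_degree v \<le> card (UNIV :: 'n set)" if "v \<in> U" for v
    using sum_bounded_above[of UNIV "Poly_Mapping.lookup v" 1] sqf that
    by (simp add: mon_degree_def)
  then have "?D \<subseteq> {..card (UNIV :: 'n set)}"
    using is_min_mon_gens_subset by blast
  then show "finite ?D" by (rule finite_subset) simp
  show "mon_degree u \<in> ?D"
    using u is_min_mon_gens_min_exps by blast
qed

section \<open>Minimal primes of square-free monomial ideals\<close>

text \<open>Some term \<open>w\<close> of \<open>f\<close> is divisible by no generator; take for
  \<open>C\<close> the variables missing from \<open>w\<close>. A square-free generator not dividing
  \<open>w\<close> must involve one of them, since its exponents are at most 1.\<close>

lemma squarefree_separating_var_ideal:
  fixes f :: "('n::{finite,linorder}, 'k::field) mpoly"
  assumes sqf: "\<forall>u\<in>U. \<forall>i. Poly_Mapping.lookup u i \<le> 1" and f: "f \<notin> monomial_ideal U"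
  shows "\<exists>C. (monomial_ideal U :: ('n, 'k) mpoly set) \<subseteq> var_ideal C 1 \<and> f \<notin> var_ideal C 1"
proof -
  obtain w where w: "w \<in> Poly_Mapping.keys f" "\<And>u. u \<in> U \<Longrightarrow> \<not> exp_dvd u w"
    using f by (auto simp: monomial_ideal_iff)
  define C where "C = {i. Poly_Mapping.lookup w i = 0}"
  have "var_weight C u \<noteq> 0" if u: "u \<in> U" for u
  proof -
    obtain i where i: "Poly_Mapping.lookup w i < Poly_Mapping.lookup u i"
      using w(2)[OF u] by (auto simp: exp_dvd_def not_le)
    moreover have "Poly_Mapping.lookup u i \<le> 1" using sqf u by blast
    ultimately show ?thesis
      by (auto simp: C_def var_weight_def intro!: exI[of _ i])
  qed
  moreover have "var_weight C w = 0"
    by (simp add: C_def var_weight_def)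
  ultimately show ?thesis
    using w(1) unfolding monomial_ideal_subset_var_ideal_iff
    by (intro exI[of _ C]) (auto simp: var_ideal_def intro!: bexI[of _ w])
qed

text \<open>A prime that contains the ideal but not \<open>f\<close> cannot contain
  \<open>f * f\<close>.\<close>

lemma squarefree_monomial_ideal_radical:
  fixes f :: "('n::{finite,linorder}, 'k::field) mpoly"
  assumes sqf: "\<forall>u\<in>U. \<forall>i. Poly_Mapping.lookup u i \<le> 1" and f: "f * f \<in> monomial_ideal U"
  shows "f \<in> monomial_ideal U"
proof (rule ccontr)
  assume "f \<notin> monomial_ideal U"
  then obtain C where C: "(monomial_ideal U :: ('n, 'k) mpoly set) \<subseteq> var_ideal C 1" "f \<notin> var_ideal C 1"
    using squarefree_separating_var_ideal[OF sqf] by blast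
  have "f * f \<in> var_ideal C 1" by (rule subsetD[OF C(1) f])
  then show False
    using C(2) primeideal_var_ideal[of C] by (auto simp: primeideal_ring_of_iff)
qed

text \<open>Split off a variable of \<open>u\<close>: by primality it lies in \<open>P\<close>, or
  the cofactor of smaller degree does and induction applies.\<close>

lemma prime_contains_variable:
  fixes P :: "('n::{finite,linorder}, 'k::field) mpoly set"
  assumes P: "primeideal P ring_of" and u: "monomial u \<in> P"
  shows "\<exists>i. Poly_Mapping.lookup u i \<noteq> 0 \<and> monomial (Poly_Mapping.single i 1) \<in> P"
  using u
proof (induction "mon_degree u" arbitrary: u rule: less_induct)
  case less
  \<comment> \<open>The monomial with exponent \<open>0\<close> is \<open>1\<close>, which is not in
    a prime.\<close>
  have "u \<noteq> 0"
    using less.prems P by (auto simp: primeideal_ring_of_iff)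
  then obtain i where i: "Poly_Mapping.lookup u i \<noteq> 0"
    by (rule poly_mapping_nonzeroE)
  let ?x = "Poly_Mapping.single i (1::nat)"
  have dvd: "exp_dvd ?x u"
    using i by (auto simp: exp_dvd_def lookup_single when_def)
  have "monomial u = monomial (u - ?x) * (monomial ?x :: ('n, 'k) mpoly)"
    using exp_dvd_split[OF dvd] by (simp add: mult_single)
  then consider "monomial (u - ?x) \<in> P" | "monomial ?x \<in> P"
    using P less.prems by (auto simp: primeideal_ring_of_iff)
  then show ?case
  proof cases
    case 1
    have sub: "exp_dvd (u - ?x) u"
      by (simp add: exp_dvd_def lookup_minus)
    moreover have "u - ?x \<noteq> u"
    proof
      assume "u - ?x = u"
      then have "Poly_Mapping.lookup (u - ?x) i = Poly_Mapping.lookup u i" by simp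
      then show False using i by (simp add: lookup_minus)
    qed
    ultimately obtain j where "Poly_Mapping.lookup (u - ?x) j \<noteq> 0" "monomial (Poly_Mapping.single j 1) \<in> P"
      using less.hyps[OF mon_degree_less_if_exp_dvd 1] by blast
    then show ?thesis
      by (auto simp: lookup_minus intro!: exI[of _ j])
  next
    case 2
    then show ?thesis using i by blast
  qed
qed

text \<open>Take for \<open>C\<close> the variables in \<open>P\<close>. They generate a prime
  inside \<open>P\<close>, and it contains every generator of the monomial ideal by
  \<open>prime_contains_variable\<close>; minimality gives equality.\<close>

lemma min_prime_eq_var_ideal:
  fixes P :: "('n::{finite,linorder}, 'k::field) mpoly set"
  assumes P: "P \<in> min_primes (monomial_ideal U)"
  shows "\<exists>C. P = var_ideal C 1"
proof -
  have pP: "primeideal P ring_of" and UP: "monomial_ideal U \<subseteq> P"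
    and min: "\<And>Q. primeideal Q ring_of \<Longrightarrow> monomial_ideal U \<subseteq> Q \<Longrightarrow> Q \<subseteq> P \<Longrightarrow> Q = P"
    using P by (auto simp: min_primes_def)
  define C where "C = {i. monomial (Poly_Mapping.single i 1) \<in> P}"
  have "var_weight C u \<noteq> 0" if "u \<in> U" for u
  proof -
    have "monomial u \<in> P"
      using UP that by (auto simp: monomial_in_monomial_ideal_iff intro!: subsetD[OF UP] bexI[of _ u])
    then show ?thesis
      using prime_contains_variable[OF pP] by (auto simp: var_weight_def C_def)
  qed
  then have UC: "(monomial_ideal U :: ('n, 'k) mpoly set) \<subseteq> var_ideal C 1"
    unfolding monomial_ideal_subset_var_ideal_iff by blast
  have "monomial_ideal ((\<lambda>i. Poly_Mapping.single i 1) ` C) \<subseteq> P"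
    using pP genideal_ring_of_subset[of P]
    by (auto simp: monomial_ideal_def C_def primeideal_ring_of_iff)
  moreover have "var_ideal C 1 \<subseteq>
      (monomial_ideal ((\<lambda>i. Poly_Mapping.single i 1) ` C) :: ('n, 'k) mpoly set)"
  proof
    fix f :: "('n, 'k) mpoly"
    assume f: "f \<in> var_ideal C 1"
    have "\<exists>u\<in>(\<lambda>i. Poly_Mapping.single i 1) ` C. exp_dvd u w" if "w \<in> Poly_Mapping.keys f" for w
    proof -
      have "var_weight C w \<noteq> 0" using f that by (auto simp: var_ideal_def)
      then obtain i where "i \<in> C" "Poly_Mapping.lookup w i \<noteq> 0"
        by (auto simp: var_weight_def)
      then have "exp_dvd (Poly_Mapping.single i 1) w"
        by (auto simp: exp_dvd_def lookup_single when_def)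
      then show ?thesis using \<open>i \<in> C\<close> by blast
    qed
    then show "f \<in> monomial_ideal ((\<lambda>i. Poly_Mapping.single i 1) ` C)"
      by (simp add: monomial_ideal_iff)
  qed
  ultimately show ?thesis
    using min[OF primeideal_var_ideal UC] by blast
qed

text \<open>Removing a variable \<open>i\<close> from \<open>C\<close> gives a strictly smaller
  prime, which by minimality misses some generator \<open>u\<close>. Within \<open>C\<close>, this
  \<open>u\<close> involves only \<open>i\<close>, and with exponent 1 by square-freeness.\<close>

lemma min_prime_generator_of_order_1:
  assumes sqf: "\<forall>u\<in>U. \<forall>i. Poly_Mapping.lookup u i \<le> 1"
    and C: "var_ideal C 1 \<in> min_primes (monomial_ideal U :: ('n::{finite,linorder}, 'k::field) mpoly set)"
    and nz: "monomial_ideal U \<noteq> ({0} :: ('n, 'k) mpoly set)"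
  shows "\<exists>u\<in>U. var_weight C u = 1"
proof -
  let ?I = "monomial_ideal U :: ('n, 'k) mpoly set"
  have UC: "?I \<subseteq> var_ideal C 1"
    and min: "\<And>Q. primeideal Q ring_of \<Longrightarrow> ?I \<subseteq> Q \<Longrightarrow> Q \<subseteq> var_ideal C 1 \<Longrightarrow> Q = var_ideal C 1"
    using C by (auto simp: min_primes_def)
  \<comment> \<open>For empty \<open>C\<close> the prime is the zero ideal, which cannot contain a
    nonzero ideal.\<close>
  have "C \<noteq> {}"
  proof
    assume "C = {}"
    then have "var_ideal C 1 = ({0} :: ('n, 'k) mpoly set)"
      by (auto simp: var_ideal_def var_weight_def)
    then show False
      using UC nz ideal_ring_ofD(1)[OF ideal_monomial_ideal[of U]] by blast
  qed
  then obtain i where i: "i \<in> C" by blast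
  let ?D = "C - {i}"
  have split: "var_weight C u = Poly_Mapping.lookup u i + var_weight ?D u" for u
    using i by (simp add: var_weight_def sum.remove)
  have "(monomial (Poly_Mapping.single i 1) :: ('n, 'k) mpoly) \<in> var_ideal C 1 - var_ideal ?D 1"
    by (simp add: var_ideal_def split) (simp add: var_weight_def lookup_single when_def)
  moreover have "var_ideal ?D 1 \<subseteq> (var_ideal C 1 :: ('n, 'k) mpoly set)"
    by (auto simp: var_ideal_def split)
  ultimately have "\<not> ?I \<subseteq> var_ideal ?D 1"
    using min[OF primeideal_var_ideal] by blast
  then obtain u where u: "u \<in> U" "var_weight ?D u = 0"
    unfolding monomial_ideal_subset_var_ideal_iff by blast
  moreover have "var_weight C u \<noteq> 0"
    using UC u(1) unfolding monomial_ideal_subset_var_ideal_iff by blast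
  moreover have "Poly_Mapping.lookup u i \<le> 1" using sqf u(1) by blast
  ultimately have "var_weight C u = 1" by (simp add: split)
  then show ?thesis using u(1) by blast
qed

section \<open>Attainment of the v-number of a square-free monomial ideal\<close>

text \<open>The witness is the product of the variables outside a vertex cover of least cardinality.\<close>

lemma v_number_attained:
  fixes U :: "('n::{finite,linorder} \<Rightarrow>\<^sub>0 nat) set"
  defines "I \<equiv> (monomial_ideal U :: ('n, 'k::field) mpoly set)"
  assumes sqf: "\<forall>u\<in>U. \<forall>i. Poly_Mapping.lookup u i \<le> 1" and proper: "I \<noteq> UNIV"
  shows "\<exists>f \<in> graded_component (v_number I). \<exists>P \<in> ass_primes I. colon I f = P"
proof -
  \<comment> \<open>Covers are the sets \<open>C\<close> whose prime \<open>var_ideal C 1\<close>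
    contains \<open>I\<close>.\<close>
  define cover where "cover C \<longleftrightarrow> (\<forall>u\<in>U. var_weight C u \<noteq> 0)" for C
  have I: "ideal I ring_of" by (simp add: I_def ideal_monomial_ideal)
  have "0 \<notin> U"
  proof
    assume "0 \<in> U"
    then have "f \<in> I" for f
      by (auto simp: I_def monomial_ideal_iff exp_dvd_def intro!: bexI[of _ 0])
    then show False using proper by blast
  qed
  have "cover UNIV"
    unfolding cover_def
  proof
    fix u assume "u \<in> U"
    then have "u \<noteq> 0" using \<open>0 \<notin> U\<close> by blast
    then show "var_weight UNIV u \<noteq> 0"
      using poly_mapping_nonzeroE[of u] by (auto simp: var_weight_def)
  qed
  then obtain C where C: "cover C" "\<And>D. cover D \<Longrightarrow> card C \<le> card D"
    using ex_has_least_nat[of cover UNIV card] by blast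
  have IC: "I \<subseteq> var_ideal C 1"
    using C(1) unfolding I_def cover_def monomial_ideal_subset_var_ideal_iff .
  define e where "e = (\<Sum>i\<in>-C. Poly_Mapping.single i (1::nat))"
  have e: "Poly_Mapping.lookup e j = (if j \<in> C then 0 else 1)" for j
    by (simp add: e_def lookup_sum lookup_single when_def)
  have prime: "primeideal (var_ideal C 1 :: ('n, 'k) mpoly set) ring_of"
    by (rule primeideal_var_ideal)
  have "h * monomial e \<in> I \<longleftrightarrow> h \<in> var_ideal C 1" for h
  proof
    assume "h * monomial e \<in> I"
    then have "h * monomial e \<in> var_ideal C 1" using IC by blast
    moreover have "(monomial e :: ('n, 'k) mpoly) \<notin> var_ideal C 1"
      by (simp add: var_ideal_def var_weight_def e)
    ultimately show "h \<in> var_ideal C 1"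
      using prime by (auto simp: primeideal_ring_of_iff)
  next
    assume h: "h \<in> var_ideal C 1"
    have "\<exists>u\<in>U. exp_dvd u w" if w: "w \<in> Poly_Mapping.keys (h * monomial e)" for w
    proof -
      obtain v where v: "w = v + e" "v \<in> Poly_Mapping.keys h"
        using w keys_mult[of h "monomial e"] by auto
      then have "var_weight C v \<noteq> 0" using h by (auto simp: var_ideal_def)
      then obtain i where i: "i \<in> C" "Poly_Mapping.lookup v i \<noteq> 0"
        by (auto simp: var_weight_def)
      \<comment> \<open>By least cardinality \<open>C - {i}\<close> is no cover, so some generator
        \<open>u\<close> uses only \<open>i\<close> and variables outside \<open>C\<close>. Being
        square-free, it divides the product of variable \<open>i\<close> and
        \<open>monomial e\<close>, hence also \<open>w\<close>.\<close>
      have "card (C - {i}) < card C"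
        using i(1) by (intro card_Diff1_less) auto
      then have "\<not> cover (C - {i})" using C(2)[of "C - {i}"] by linarith
      then obtain u where u: "u \<in> U" "var_weight (C - {i}) u = 0"
        by (auto simp: cover_def)
      have "exp_dvd u w"
        unfolding exp_dvd_def
      proof
        fix j
        have "Poly_Mapping.lookup u j \<le> 1" using sqf u(1) by blast
        moreover have "Poly_Mapping.lookup u j = 0" if "j \<in> C" "j \<noteq> i"
          using u(2) that by (simp add: var_weight_def)
        ultimately show "Poly_Mapping.lookup u j \<le> Poly_Mapping.lookup w j"
          using i by (cases "j = i") (auto simp: v(1) lookup_add e)
      qed
      then show ?thesis using u(1) by blast
    qed
    then show "h * monomial e \<in> I" by (simp add: I_def monomial_ideal_iff)
  qed
  then have "colon I (monomial e) = var_ideal C 1"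
    by (auto simp: colon_def)
  moreover from this have "var_ideal C 1 \<in> ass_primes I"
    by (rule ass_primesI[OF I prime])
  moreover have "monomial e \<in> (graded_component (mon_degree e) :: ('n, 'k) mpoly set)"
    by (simp add: graded_component_def)
  ultimately have "\<exists>f \<in> graded_component (mon_degree e). \<exists>P \<in> ass_primes I. colon I f = P"
    by (intro bexI)
  \<comment> \<open>\<open>LEAST\<close> has its defining property only once some degree is known to
    qualify; the degree of \<open>e\<close> does.\<close>
  then show ?thesis
    unfolding v_number_def
    by (rule LeastI[where P = "\<lambda>d. \<exists>f \<in> graded_component d. \<exists>P \<in> ass_primes I. colon I f = P"])
qed

section \<open>The bound for symbolic powers\<close>

lemma graded_component_mult:
  assumes "f \<in> graded_component a" "g \<in> graded_component b"
  shows "f * g \<in> graded_component (a + b)"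
proof -
  have "mon_degree w = a + b" if w: "w \<in> Poly_Mapping.keys (f * g)" for w
  proof -
    obtain x y where "w = x + y" "x \<in> Poly_Mapping.keys f" "y \<in> Poly_Mapping.keys g"
      using w keys_mult[of f g] by blast
    then show ?thesis
      using assms by (simp add: graded_component_def mon_degree_def lookup_add sum.distrib)
  qed
  then show ?thesis by (simp add: graded_component_def)
qed

theorem corollary4p6:
  fixes I :: "('n::{finite,linorder}, 'k::field) mpoly set"
  assumes "is_squarefree_monomial_ideal I"
    and "I \<noteq> {0}"
    and "I \<noteq> UNIV"
  shows "\<forall>k\<ge>1::nat. v_number (symbolic_power I k) \<le> (k - 1) * max_gen_degree I + v_number I"
proof (intro allI impI)
  fix k :: nat assume "k \<ge> 1"
  then obtain m where k: "k = Suc m" by (cases k) auto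
  obtain U where sqf: "\<forall>u\<in>U. \<forall>i. Poly_Mapping.lookup u i \<le> 1" and IU: "I = monomial_ideal U"
    using assms(1) by (auto simp: is_squarefree_monomial_ideal_def)
  have I: "ideal I ring_of" by (simp add: IU ideal_monomial_ideal)
  obtain f P where f: "f \<in> graded_component (v_number I)" and "P \<in> ass_primes I" and fP: "colon I f = P"
    using v_number_attained[OF sqf assms(3)[unfolded IU]] unfolding IU[symmetric] by (elim bexE)
  then have P: "primeideal P ring_of" by (simp add: ass_primes_def)
  have fmem: "h * f \<in> I \<longleftrightarrow> h \<in> P" for h
    using fP by (auto simp: colon_def)
  \<comment> \<open>Otherwise \<open>f * f\<close> lies in \<open>I\<close>, so \<open>f\<close>
    does by radicality, and then \<open>1\<close> lies in \<open>P\<close>.\<close>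
  have "f \<notin> P"
  proof
    assume "f \<in> P"
    then have "f \<in> I"
      using fmem squarefree_monomial_ideal_radical[OF sqf] IU by blast
    then show False
      using fmem[of 1] P by (simp add: primeideal_ring_of_iff)
  qed
  have "P \<in> min_primes I"
  proof -
    have "I \<subseteq> P"
      using fmem ideal_ring_ofD(3)[OF I] by (auto simp: mult.commute)
    moreover have "Q = P" if Q: "primeideal Q ring_of" "I \<subseteq> Q" "Q \<subseteq> P" for Q
    proof -
      \<comment> \<open>Here \<open>h * f\<close> lies in \<open>I\<close>, hence in
        \<open>Q\<close>, while \<open>f\<close> is outside \<open>P\<close> and so outside
        \<open>Q\<close>.\<close>
      have "h \<in> Q" if "h \<in> P" for h
        using Q that fmem[of h] \<open>f \<notin> P\<close> unfolding primeideal_ring_of_iff by blast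
      then show ?thesis using Q(3) by blast
    qed
    ultimately show ?thesis using P by (simp add: min_primes_def)
  qed
  then obtain C where C: "P = var_ideal C 1"
    using min_prime_eq_var_ideal IU by blast
  \<comment> \<open>Passing to the minimal generators ensures that the degree of the chosen
    \<open>u\<close> is bounded by \<open>max_gen_degree I\<close>.\<close>
  have IM: "I = monomial_ideal (min_exps U)"
    by (simp add: IU monomial_ideal_min_exps)
  have "\<exists>u\<in>min_exps U. var_weight C u = 1"
    using \<open>P \<in> min_primes I\<close> assms(2) sqf unfolding C IM
    by (intro min_prime_generator_of_order_1) (auto simp: min_exps_def)
  then obtain u where u: "u \<in> min_exps U" "var_weight C u = 1" by blast
  have uI: "monomial u \<in> I"
    using u(1) by (auto simp: IM monomial_in_monomial_ideal_iff intro: bexI[of _ u])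
  define g where "g = f * monomial u ^ m"
  have degree_power: "monomial u ^ j \<in> graded_component (j * mon_degree u)" for j
  proof (induction j)
    case 0
    show ?case by (simp add: graded_component_def mon_degree_def)
  next
    case (Suc j)
    have "monomial u \<in> graded_component (mon_degree u)"
      by (simp add: graded_component_def)
    then show ?case
      using graded_component_mult[OF _ Suc.IH] by simp
  qed
  \<comment> \<open>The order of \<open>monomial u\<close> is 1, so that of its \<open>j\<close>-th
    power is at most \<open>j\<close>.\<close>
  have order_power: "(monomial u ^ j :: ('n, 'k) mpoly) \<notin> var_ideal C (Suc j)" for j
  proof (induction j)
    case 0
    show ?case by (simp add: var_ideal_def var_weight_def)
  next
    case (Suc j)
    have "(monomial u :: ('n, 'k) mpoly) \<notin> var_ideal C (Suc 1)"
      using u(2) by (simp add: var_ideal_def)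
    from var_ideal_mult_notin[OF this Suc.IH] show ?case by simp
  qed
  have "h * g \<in> symbolic_power I k \<longleftrightarrow> h \<in> P" for h
  proof
    assume "h \<in> P"
    then have "monomial u ^ m * (h * f) \<in> ideal_pow I (Suc m)"
      using fmem by (intro ideal_pow_Suc_memI power_in_ideal_pow uI) auto
    moreover have "monomial u ^ m * (h * f) = h * g"
      by (simp add: g_def ac_simps)
    ultimately have "h * g \<in> ideal_pow I (Suc m)" by (simp only:)
    then show "h * g \<in> symbolic_power I k"
      unfolding k by (rule subsetD[OF ideal_pow_subset_symbolic_power[OF I]])
  next
    assume "h * g \<in> symbolic_power I k"
    then obtain s where s: "s \<notin> P" "s * (h * g) \<in> ideal_pow I k"
      using \<open>P \<in> min_primes I\<close> unfolding in_symbolic_power_iff[OF I] by blast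
    have "I \<subseteq> var_ideal C 1"
      using \<open>P \<in> min_primes I\<close> C by (simp add: min_primes_def)
    then have hs: "s * (h * g) \<in> var_ideal C (Suc m)"
      using s(2) ideal_pow_subset_var_ideal k by blast
    show "h \<in> P"
    proof (rule ccontr)
      assume "h \<notin> P"
      then have "s * h * f \<notin> P"
        using s(1) \<open>f \<notin> P\<close> P by (auto simp: primeideal_ring_of_iff)
      \<comment> \<open>The first factor has order 0 and the second at most \<open>m\<close>, so the
        product has order below \<open>k = Suc m\<close>.\<close>
      then have "(s * h * f) * monomial u ^ m \<notin> var_ideal C (Suc (0 + m))"
        by (intro var_ideal_mult_notin order_power) (simp add: C)
      then show False using hs by (simp add: g_def ac_simps)
    qed
  qed
  then have col: "colon (symbolic_power I k) g = P"
    by (auto simp: colon_def)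
  then have "P \<in> ass_primes (symbolic_power I k)"
    by (rule ass_primesI[OF ideal_symbolic_power[OF I] P])
  moreover have "g \<in> graded_component (v_number I + m * mon_degree u)"
    unfolding g_def by (intro graded_component_mult f degree_power)
  ultimately have "\<exists>f \<in> graded_component (v_number I + m * mon_degree u).
      \<exists>P \<in> ass_primes (symbolic_power I k). colon (symbolic_power I k) f = P"
    using col by (intro bexI)
  then have "v_number (symbolic_power I k) \<le> v_number I + m * mon_degree u"
    unfolding v_number_def[of "symbolic_power I k"] by (rule Least_le)
  also have "\<dots> \<le> v_number I + m * max_gen_degree I"
    using mon_degree_le_max_gen_degree[OF sqf u(1), where 'k = 'k] by (simp add: IU)
  finally show "v_number (symbolic_power I k) \<le> (k - 1) * max_gen_degree I + v_number I"
    by (simp add: k add.commute)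
qed

end
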